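(* The functor $fm_g:\mathbf{Graded\ Fuzzy\ TopSys}\to\mathbf{Graded\ Frm}^{op}$, given by $fm_g(X,\models,A,R)=(A,R)$ and $fm_g(f_1,f_2)=f_2$, is left adjoint to the functor $S_g:\mathbf{Graded\ Frm}^{op}\to\mathbf{Graded\ Fuzzy\ TopSys}$, given by $S_g((A,R))=(Hom_g((A,R),([0,1],R^* )),\models_*,A,R)$ with $gr(v\models_* a)=v(a)$, and $S_g(f)=(\_\circ f,f)$.
   Context: In $[0,1]$, $\wedge$ is minimum. A graded frame $(A,R)$ is a 5-tuple $(A,\top,\wedge,\bigvee,R)$ with $A$ a non-empty set, $\top\in A$, $\wedge$ a binary operation, $\bigvee$ an operation on arbitrary subsets of $A$, and $R:A\times A\to[0,1]$ such that for all $a,b,c\in A$, $S\subseteq A$: (1) $R(a,a)=1$; (2) $R(a,b)=1=R(b,a)$ implies $a=b$; (3) $R(a,b)\wedge R(b,c)\le R(a,c)$; (4) $R(a\wedge b,a)=1=R(a\wedge b,b)$; (5) $R(a,\top)=1$; (6) $R(a,b)\wedge R(a,c)=R(a,b\wedge c)$; (7) $R(a,\bigvee S)=1$ if $a\in S$; (8) $\inf\{R(a,b)\mid a\in S\}=R(\bigvee S,b)$; (9) $R(a\wedge\bigvee S,\bigvee\{a\wedge b\mid b\in S\})=1$. $\mathbf{Graded\ Frm}$ has graded frames as objects and graded frame homomorphisms as morphisms: maps $f:(A,R)\to(B,R')$ with $f(a_1\wedge a_2)=f(a_1)\wedge f(a_2)$, $f(\bigvee_i a_i)=\bigvee_i f(a_i)$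 and $R(a_1,a_2)\le R'(f(a_1),f(a_2))$. $([0,1],R^* )$ is the graded frame $[0,1]$ with minimum, supremum, top $1$, and $R^*(a,b)=1$ if $a\le b$, $R^*(a,b)=b$ if $a>b$. $Hom_g((A,R),([0,1],R^* ))$ is the set of graded frame homomorphisms $v:(A,R)\to([0,1],R^* )$; $\_\circ f$ is $v\mapsto v\circ f$. $\mathbf{Graded\ Fuzzy\ TopSys}$: objects are graded fuzzy topological systems $(X,\models,A,R)$, with $X$ a non-empty set, $(A,R)$ a graded frame and $\models$ a function $(x,a)\mapsto gr(x\models a)\in[0,1]$ such that (1) $gr(x\models a)\wedge R(a,b)\le gr(x\models b)$; (2) $gr(x\models\bigwedge S)=\inf\{gr(x\models a)\mid a\in S\}$ for finite $S\subseteq A$, including $S=\emptyset$ (where $\bigwedge\emptyset=\top$, $\inf\emptyset=1$); (3) $gr(x\models\bigvee S)=\sup\{gr(x\models a)\mid a\in S\}$ for every $S\subseteq A$ (with $\sup\emptyset=0$). A morphism $(X,\models,A,R)\to(Y,\models',B,R')$ is a pair $(f_1,f_2)$ with $f_1:X\to Y$ a function, $f_2:(B,R')\to(A,R)$ a graded frame homomorphism and $gr(x\models f_2(b))=gr(f_1(x)\models'b)$ for all $x\in X,b\in B$. Composition is $(g_1,g_2)\circ(f_1,f_2)=(g_1\circ f_1,f_2\circ g_2)$.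
   Formalization: As stated S_g is ill-defined: the constant map 0 lies in Hom_g but violates gr(v⊨⊤)=1. Proved instead: homomorphisms preserve ⊤ and X may be empty; or they preserve ⊤ with X and Hom_g non-empty; or homomorphisms as stated, X non-empty, and condition (2) only for non-empty S. *)

theory Defs
  imports Complex_Main "HOL-Library.FuncSet"
begin

text \<open>
  Arrows do not carry their domain and codomain, so composition and the arrow part of a functor
  take the objects involved as arguments: \<open>cmp C X Y Z g f\<close> is \<open>g\<close> after \<open>f\<close> for
  \<open>f : X \<rightarrow> Y\<close> and \<open>g : Y \<rightarrow> Z\<close>.
\<close>

record ('o, 'm) category =
  obj :: "'o set"
  arr :: "'o \<Rightarrow> 'o \<Rightarrow> 'm set"
  idt :: "'o \<Rightarrow> 'm"
  cmp :: "'o \<Rightarrow> 'o \<Rightarrow> 'o \<Rightarrow> 'm \<Rightarrow> 'm \<Rightarrow> 'm"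

definition is_category :: "('o, 'm) category \<Rightarrow> bool" where
  "is_category C \<longleftrightarrow>
     (\<forall>X\<in>obj C. idt C X \<in> arr C X X) \<and>
     (\<forall>X\<in>obj C. \<forall>Y\<in>obj C. \<forall>Z\<in>obj C. \<forall>f\<in>arr C X Y. \<forall>g\<in>arr C Y Z.
        cmp C X Y Z g f \<in> arr C X Z) \<and>
     (\<forall>X\<in>obj C. \<forall>Y\<in>obj C. \<forall>f\<in>arr C X Y.
        cmp C X X Y f (idt C X) = f \<and> cmp C X Y Y (idt C Y) f = f) \<and>
     (\<forall>W\<in>obj C. \<forall>X\<in>obj C. \<forall>Y\<in>obj C. \<forall>Z\<in>obj C.
        \<forall>f\<in>arr C W X. \<forall>g\<in>arr C X Y. \<forall>h\<in>arr C Y Z.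
        cmp C W X Z (cmp C X Y Z h g) f = cmp C W Y Z h (cmp C W X Y g f))"

definition op_cat :: "('o, 'm) category \<Rightarrow> ('o, 'm) category" where
  "op_cat C = \<lparr>obj = obj C, arr = (\<lambda>X Y. arr C Y X), idt = idt C,
               cmp = (\<lambda>X Y Z g f. cmp C Z Y X f g)\<rparr>"

definition full_subcat :: "('o, 'm) category \<Rightarrow> ('o \<Rightarrow> bool) \<Rightarrow> ('o, 'm) category" where
  "full_subcat C P = C\<lparr>obj := {X \<in> obj C. P X}\<rparr>"

record ('o1, 'm1, 'o2, 'm2) cat_functor =
  omap :: "'o1 \<Rightarrow> 'o2"
  amap :: "'o1 \<Rightarrow> 'o1 \<Rightarrow> 'm1 \<Rightarrow> 'm2"

definition is_functor ::
  "('o1, 'm1) category \<Rightarrow> ('o2, 'm2) category \<Rightarrow> ('o1, 'm1, 'o2, 'm2) cat_functor \<Rightarrow> bool" where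
  "is_functor C D F \<longleftrightarrow>
     (\<forall>X\<in>obj C. omap F X \<in> obj D) \<and>
     (\<forall>X\<in>obj C. \<forall>Y\<in>obj C. \<forall>f\<in>arr C X Y. amap F X Y f \<in> arr D (omap F X) (omap F Y)) \<and>
     (\<forall>X\<in>obj C. amap F X X (idt C X) = idt D (omap F X)) \<and>
     (\<forall>X\<in>obj C. \<forall>Y\<in>obj C. \<forall>Z\<in>obj C. \<forall>f\<in>arr C X Y. \<forall>g\<in>arr C Y Z.
        amap F X Z (cmp C X Y Z g f) =
        cmp D (omap F X) (omap F Y) (omap F Z) (amap F Y Z g) (amap F X Y f))"

text \<open>
  \<open>F : C \<rightarrow> D\<close> is left adjoint to \<open>G : D \<rightarrow> C\<close>: there are bijections
  \<open>D(F X, Y) \<cong> C(X, G Y)\<close> natural in \<open>X\<close> and \<open>Y\<close>.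
\<close>

definition left_adjoint ::
  "('o1, 'm1) category \<Rightarrow> ('o2, 'm2) category \<Rightarrow>
   ('o1, 'm1, 'o2, 'm2) cat_functor \<Rightarrow> ('o2, 'm2, 'o1, 'm1) cat_functor \<Rightarrow> bool" where
  "left_adjoint C D F G \<longleftrightarrow>
     is_category C \<and> is_category D \<and> is_functor C D F \<and> is_functor D C G \<and>
     (\<exists>\<phi>.
        (\<forall>X\<in>obj C. \<forall>Y\<in>obj D. bij_betw (\<phi> X Y) (arr D (omap F X) Y) (arr C X (omap G Y))) \<and>
        (\<forall>X\<in>obj C. \<forall>X'\<in>obj C. \<forall>Y\<in>obj D. \<forall>Y'\<in>obj D.
           \<forall>f\<in>arr C X' X. \<forall>g\<in>arr D (omap F X) Y. \<forall>h\<in>arr D Y Y'.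
           \<phi> X' Y' (cmp D (omap F X') Y Y' h (cmp D (omap F X') (omap F X) Y g (amap F X' X f))) =
           cmp C X' (omap G Y) (omap G Y') (amap G Y Y' h) (cmp C X' X (omap G Y) (\<phi> X Y g) f)))"

text \<open>
  Infimum and supremum of subsets of \<open>[0,1]\<close>; in \<open>real\<close> the values of \<open>Inf {}\<close> and
  \<open>Sup {}\<close> are not \<open>1\<close> and \<open>0\<close>.
\<close>

definition uInf :: "real set \<Rightarrow> real" where
  "uInf S = (if S = {} then 1 else Inf S)"

definition uSup :: "real set \<Rightarrow> real" where
  "uSup S = (if S = {} then 0 else Sup S)"

record 'a gframe =
  carr :: "'a set"
  gtop :: 'a
  meet :: "'a \<Rightarrow> 'a \<Rightarrow> 'a"
  join :: "'a set \<Rightarrow> 'a"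
  rel :: "'a \<Rightarrow> 'a \<Rightarrow> real"

definition graded_frame :: "'a gframe \<Rightarrow> bool" where
  "graded_frame A \<longleftrightarrow>
     carr A \<noteq> {} \<and>
     gtop A \<in> carr A \<and>
     (\<forall>a\<in>carr A. \<forall>b\<in>carr A. meet A a b \<in> carr A) \<and>
     (\<forall>S. S \<subseteq> carr A \<longrightarrow> join A S \<in> carr A) \<and>
     (\<forall>a\<in>carr A. \<forall>b\<in>carr A. rel A a b \<in> {0..1}) \<and>
     (\<forall>a\<in>carr A. rel A a a = 1) \<and>
     (\<forall>a\<in>carr A. \<forall>b\<in>carr A. rel A a b = 1 \<and> rel A b a = 1 \<longrightarrow> a = b) \<and>
     (\<forall>a\<in>carr A. \<forall>b\<in>carr A. \<forall>c\<in>carr A. min (rel A a b) (rel A b c) \<le> rel A a c) \<and>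
     (\<forall>a\<in>carr A. \<forall>b\<in>carr A. rel A (meet A a b) a = 1 \<and> rel A (meet A a b) b = 1) \<and>
     (\<forall>a\<in>carr A. rel A a (gtop A) = 1) \<and>
     (\<forall>a\<in>carr A. \<forall>b\<in>carr A. \<forall>c\<in>carr A.
        min (rel A a b) (rel A a c) = rel A a (meet A b c)) \<and>
     (\<forall>S. S \<subseteq> carr A \<longrightarrow> (\<forall>a\<in>S. rel A a (join A S) = 1)) \<and>
     (\<forall>S. S \<subseteq> carr A \<longrightarrow> (\<forall>b\<in>carr A. uInf {rel A a b |a. a \<in> S} = rel A (join A S) b)) \<and>
     (\<forall>S. S \<subseteq> carr A \<longrightarrow> (\<forall>a\<in>carr A.
        rel A (meet A a (join A S)) (join A {meet A a b |b. b \<in> S}) = 1))"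

text \<open>
  The flag \<open>t\<close> says whether the empty meet \<open>\<top>\<close> counts among the finite meets that are
  preserved, here by homomorphisms and below by the satisfaction relation of a system. The two
  notions must agree on this: if systems satisfied \<open>gr(x \<Turnstile> \<top>) = 1\<close> but homomorphisms were
  not required to preserve \<open>\<top>\<close>, the constant map \<open>0\<close> would be a point \<open>v\<close> of every graded
  frame with \<open>v(\<top>) = 0\<close>, and the points of a graded frame would not form a system.

  Homomorphisms are extensional functions, so that equality of homomorphisms is equality on the
  carrier.
\<close>

definition gframe_hom :: "bool \<Rightarrow> 'a gframe \<Rightarrow> 'b gframe \<Rightarrow> ('a \<Rightarrow> 'b) set" where
  "gframe_hom t A B =
     {f \<in> carr A \<rightarrow>\<^sub>E carr B.
        (\<forall>a\<in>carr A. \<forall>b\<in>carr A. f (meet A a b) = meet B (f a) (f b)) \<and>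
        (t \<longrightarrow> f (gtop A) = gtop B) \<and>
        (\<forall>S. S \<subseteq> carr A \<longrightarrow> f (join A S) = join B (f ` S)) \<and>
        (\<forall>a\<in>carr A. \<forall>b\<in>carr A. rel A a b \<le> rel B (f a) (f b))}"

definition Graded_Frm :: "bool \<Rightarrow> ('a gframe, 'a \<Rightarrow> 'a) category" where
  "Graded_Frm t =
     \<lparr>obj = {A. graded_frame A},
      arr = gframe_hom t,
      idt = (\<lambda>A. \<lambda>a\<in>carr A. a),
      cmp = (\<lambda>A B C g f. compose (carr A) g f)\<rparr>"

definition unit_gframe :: "real gframe" where
  "unit_gframe =
     \<lparr>carr = {0..1}, gtop = 1, meet = min, join = uSup,
      rel = (\<lambda>a b. if a \<le> b then 1 else b)\<rparr>"

definition Hom_g :: "bool \<Rightarrow> 'a gframe \<Rightarrow> ('a \<Rightarrow> real) set" where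
  "Hom_g t A = gframe_hom t A unit_gframe"

record ('x, 'a) gsys =
  points :: "'x set"
  sat :: "'x \<Rightarrow> 'a \<Rightarrow> real"
  frame :: "'a gframe"

text \<open>
  A finite set \<open>S\<close> is given by a list enumerating it; its meet is the iterated binary meet,
  with \<open>\<top>\<close> for the empty list. The point set may be empty here; systems with a nonempty point
  set form a full subcategory.
\<close>

definition graded_fuzzy_topsys :: "bool \<Rightarrow> ('x, 'a) gsys \<Rightarrow> bool" where
  "graded_fuzzy_topsys t X \<longleftrightarrow>
     graded_frame (frame X) \<and>
     (\<forall>x\<in>points X. \<forall>a\<in>carr (frame X). sat X x a \<in> {0..1}) \<and>
     (\<forall>x\<in>points X. \<forall>a\<in>carr (frame X). \<forall>b\<in>carr (frame X).
        min (sat X x a) (rel (frame X) a b) \<le> sat X x b) \<and>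
     (\<forall>x\<in>points X. \<forall>as. set as \<subseteq> carr (frame X) \<and> (t \<or> as \<noteq> []) \<longrightarrow>
        sat X x (foldr (meet (frame X)) as (gtop (frame X))) = uInf {sat X x a |a. a \<in> set as}) \<and>
     (\<forall>x\<in>points X. \<forall>S. S \<subseteq> carr (frame X) \<longrightarrow>
        sat X x (join (frame X) S) = uSup {sat X x a |a. a \<in> S})"

definition gsys_hom ::
  "bool \<Rightarrow> ('x, 'a) gsys \<Rightarrow> ('y, 'b) gsys \<Rightarrow> (('x \<Rightarrow> 'y) \<times> ('b \<Rightarrow> 'a)) set" where
  "gsys_hom t X Y =
     {(f1, f2). f1 \<in> points X \<rightarrow>\<^sub>E points Y \<and> f2 \<in> gframe_hom t (frame Y) (frame X) \<and>
        (\<forall>x\<in>points X. \<forall>b\<in>carr (frame Y). sat X x (f2 b) = sat Y (f1 x) b)}"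

definition Graded_Fuzzy_TopSys ::
  "bool \<Rightarrow> (('x, 'a) gsys, ('x \<Rightarrow> 'x) \<times> ('a \<Rightarrow> 'a)) category" where
  "Graded_Fuzzy_TopSys t =
     \<lparr>obj = {X. graded_fuzzy_topsys t X},
      arr = gsys_hom t,
      idt = (\<lambda>X. (\<lambda>x\<in>points X. x, \<lambda>a\<in>carr (frame X). a)),
      cmp = (\<lambda>X Y Z (g1, g2) (f1, f2).
               (compose (points X) g1 f1, compose (carr (frame Z)) f2 g2))\<rparr>"

text \<open>
  Types act as universes. As \<open>S_g\<close> has homomorphisms into \<open>[0,1]\<close> as points, systems over a
  graded frame in \<open>'a\<close> have their points in \<open>'a \<Rightarrow> real\<close> when the two functors are combined;
  since \<open>'a\<close> is arbitrary and carriers need not exhaust it, this does not bound the size of point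
  sets relative to that of carriers.

  An arrow \<open>A \<rightarrow> B\<close> in the opposite of the category of graded frames is a homomorphism from
  \<open>B\<close> to \<open>A\<close>.
\<close>

definition fm_g ::
  "(('x, 'a) gsys, ('x \<Rightarrow> 'x) \<times> ('a \<Rightarrow> 'a), 'a gframe, 'a \<Rightarrow> 'a) cat_functor" where
  "fm_g = \<lparr>omap = frame, amap = (\<lambda>X Y (f1, f2). f2)\<rparr>"

definition S_g ::
  "bool \<Rightarrow> ('a gframe, 'a \<Rightarrow> 'a, ('a \<Rightarrow> real, 'a) gsys,
    (('a \<Rightarrow> real) \<Rightarrow> ('a \<Rightarrow> real)) \<times> ('a \<Rightarrow> 'a)) cat_functor" where
  "S_g t =
     \<lparr>omap = (\<lambda>A. \<lparr>points = Hom_g t A, sat = (\<lambda>v a. v a), frame = A\<rparr>),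
      amap = (\<lambda>A B f. (\<lambda>v\<in>Hom_g t A. compose (carr B) v f, f))\<rparr>"

end

theory Submission imports Defs begin

text \<open>
  A point \<open>x\<close> of a system \<open>(X, \<Turnstile>, A, R)\<close> is the same thing as a way of evaluating the elements of
  \<open>A\<close> in \<open>[0,1]\<close>: the map \<open>a \<mapsto> gr(x \<Turnstile> a)\<close>. The system axioms for \<open>x\<close> say exactly that this map is
  a graded frame homomorphism into \<open>([0,1], R\<^sup>*)\<close>. For meets and joins this is a direct comparison. For
  the grading it rests on the fact that \<open>R\<^sup>*\<close> is the residual of \<open>min\<close>, that is,
  \<open>r \<le> R\<^sup>*(p, q)\<close> iff \<open>min p r \<le> q\<close> (\<open>le_rel_unit_gframe_iff\<close>), so the axiom
  \<open>gr(x \<Turnstile> a) \<and> R(a, b) \<le> gr(x \<Turnstile> b)\<close> is the monotonicity of the evaluation with respect to the gradings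
  (\<open>sat_in_Hom_g\<close>). Read backwards, the same equivalence shows that all the homomorphisms into
  \<open>[0,1]\<close> form a system (\<open>graded_fuzzy_topsys_S_g\<close>), which gives \<open>S_g\<close>.

  The adjunction follows. An arrow from \<open>X\<close> to \<open>S_g(B)\<close> is a pair \<open>(f\<^sub>1, f\<^sub>2)\<close> with
  \<open>f\<^sub>1(x)(b) = gr(x \<Turnstile> f\<^sub>2(b))\<close>. Hence \<open>f\<^sub>1\<close> is determined by the homomorphism \<open>f\<^sub>2\<close>, and every
  homomorphism \<open>f\<^sub>2\<close> from \<open>B\<close> to the frame of \<open>X\<close> occurs, since evaluating at \<open>x\<close> after \<open>f\<^sub>2\<close> is a
  homomorphism into \<open>[0,1]\<close>. So \<open>f\<^sub>2 \<mapsto> (f\<^sub>1, f\<^sub>2)\<close> is the required bijection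
  (\<open>bij_betw_system_transpose\<close>), and it is natural because satisfaction is invariant along arrows of systems.

  The argument is uniform in the flag that tells whether \<open>\<top>\<close> counts among the preserved meets, and it
  first gives the adjunction with arbitrary point sets. The versions with nonempty point sets are
  restrictions of the adjunction to full subcategories that the two functors map into each other (\<open>left_adjoint_full_subcat\<close>). A point of
  \<open>X\<close> yields a homomorphism from its frame to \<open>[0,1]\<close>, so the frames with a homomorphism to
  \<open>[0,1]\<close> are the right subcategory; when \<open>\<top>\<close> need not be preserved, the constant \<open>0\<close> shows that
  these are all the graded frames.
\<close>

section \<open>Opposite categories, full subcategories and restricted adjunctions\<close>

lemma is_category_op_cat:
  assumes "is_category C"
  shows "is_category (op_cat C)"
proof -
  have "cmp C Z X W f (cmp C Z Y X g h) = cmp C Z Y W (cmp C Y X W f g) h"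
    if "W \<in> obj C" "X \<in> obj C" "Y \<in> obj C" "Z \<in> obj C"
      "f \<in> arr C X W" "g \<in> arr C Y X" "h \<in> arr C Z Y" for W X Y Z f g h
    using assms that unfolding is_category_def by metis
  then show ?thesis
    using assms unfolding is_category_def op_cat_def by simp
qed

lemma full_subcat_simps [simp]:
  "obj (full_subcat C P) = {X \<in> obj C. P X}"
  "arr (full_subcat C P) = arr C"
  "idt (full_subcat C P) = idt C"
  "cmp (full_subcat C P) = cmp C"
  by (simp_all add: full_subcat_def)

lemma op_cat_full_subcat: "op_cat (full_subcat C P) = full_subcat (op_cat C) P"
  by (simp add: op_cat_def full_subcat_def)

lemma full_subcat_eq_self:
  assumes "\<And>X. X \<in> obj C \<Longrightarrow> P X"
  shows "full_subcat C P = C"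
proof -
  have "{X \<in> obj C. P X} = obj C" using assms by blast
  then show ?thesis by (simp add: full_subcat_def)
qed

lemma is_category_full_subcat:
  assumes "is_category C"
  shows "is_category (full_subcat C P)"
  using assms unfolding is_category_def by simp

lemma is_functor_full_subcat:
  assumes "is_functor C D F" and "\<And>X. X \<in> obj C \<Longrightarrow> P X \<Longrightarrow> Q (omap F X)"
  shows "is_functor (full_subcat C P) (full_subcat D Q) F"
  using assms unfolding is_functor_def by simp

text \<open>
  Full subcategories keep all arrows between their objects, so the bijections between the arrow sets
  can be reused as they are.
\<close>

lemma left_adjoint_full_subcat:
  assumes adj: "left_adjoint C D F G"
    and F: "\<And>X. X \<in> obj C \<Longrightarrow> P X \<Longrightarrow> Q (omap F X)"
    and G: "\<And>Y. Y \<in> obj D \<Longrightarrow> Q Y \<Longrightarrow> P (omap G Y)"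
  shows "left_adjoint (full_subcat C P) (full_subcat D Q) F G"
proof -
  have "is_category (full_subcat C P)" "is_category (full_subcat D Q)"
    "is_functor (full_subcat C P) (full_subcat D Q) F"
    "is_functor (full_subcat D Q) (full_subcat C P) G"
    using adj F G
    by (auto simp: left_adjoint_def intro!: is_category_full_subcat is_functor_full_subcat)
  moreover obtain \<phi> where
    "\<forall>X\<in>obj C. \<forall>Y\<in>obj D. bij_betw (\<phi> X Y) (arr D (omap F X) Y) (arr C X (omap G Y))"
    "\<forall>X\<in>obj C. \<forall>X'\<in>obj C. \<forall>Y\<in>obj D. \<forall>Y'\<in>obj D.
       \<forall>f\<in>arr C X' X. \<forall>g\<in>arr D (omap F X) Y. \<forall>h\<in>arr D Y Y'.
       \<phi> X' Y' (cmp D (omap F X') Y Y' h (cmp D (omap F X') (omap F X) Y g (amap F X' X f))) =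
       cmp C X' (omap G Y) (omap G Y') (amap G Y Y' h) (cmp C X' X (omap G Y) (\<phi> X Y g) f)"
    using adj unfolding left_adjoint_def by blast
  ultimately show ?thesis
    unfolding left_adjoint_def by (intro conjI exI[of _ \<phi>]) simp_all
qed

section \<open>Graded frame homomorphisms\<close>

lemma gframe_homI:
  assumes "f \<in> carr A \<rightarrow>\<^sub>E carr B"
    and "\<And>a b. a \<in> carr A \<Longrightarrow> b \<in> carr A \<Longrightarrow> f (meet A a b) = meet B (f a) (f b)"
    and "t \<Longrightarrow> f (gtop A) = gtop B"
    and "\<And>S. S \<subseteq> carr A \<Longrightarrow> f (join A S) = join B (f ` S)"
    and "\<And>a b. a \<in> carr A \<Longrightarrow> b \<in> carr A \<Longrightarrow> rel A a b \<le> rel B (f a) (f b)"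
  shows "f \<in> gframe_hom t A B"
  using assms unfolding gframe_hom_def by simp

lemma gframe_homD:
  assumes "f \<in> gframe_hom t A B"
  shows "f \<in> carr A \<rightarrow>\<^sub>E carr B"
    and "a \<in> carr A \<Longrightarrow> b \<in> carr A \<Longrightarrow> f (meet A a b) = meet B (f a) (f b)"
    and "t \<Longrightarrow> f (gtop A) = gtop B"
    and "S \<subseteq> carr A \<Longrightarrow> f (join A S) = join B (f ` S)"
    and "a \<in> carr A \<Longrightarrow> b \<in> carr A \<Longrightarrow> rel A a b \<le> rel B (f a) (f b)"
  using assms unfolding gframe_hom_def by simp_all

lemma gframe_hom_mem:
  "f \<in> gframe_hom t A B \<Longrightarrow> a \<in> carr A \<Longrightarrow> f a \<in> carr B"
  by (auto dest: gframe_homD(1))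

lemma gframe_hom_extensional:
  "f \<in> gframe_hom t A B \<Longrightarrow> f \<in> extensional (carr A)"
  by (auto dest: gframe_homD(1) simp: PiE_def)

lemma graded_frame_closed:
  assumes "graded_frame A"
  shows "gtop A \<in> carr A"
    and "a \<in> carr A \<Longrightarrow> b \<in> carr A \<Longrightarrow> meet A a b \<in> carr A"
    and "S \<subseteq> carr A \<Longrightarrow> join A S \<in> carr A"
  using assms unfolding graded_frame_def by simp_all

lemma graded_frame_rel:
  assumes "graded_frame A" and "a \<in> carr A"
  shows "rel A a a = 1"
    and "b \<in> carr A \<Longrightarrow> rel A a b = 1 \<Longrightarrow> rel A b a = 1 \<Longrightarrow> a = b"
    and "b \<in> carr A \<Longrightarrow> rel A (meet A a b) a = 1"
    and "rel A a (gtop A) = 1"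
    and "b \<in> carr A \<Longrightarrow> c \<in> carr A \<Longrightarrow> min (rel A a b) (rel A a c) = rel A a (meet A b c)"
    and "b \<in> carr A \<Longrightarrow> rel A a b \<le> 1"
  using assms unfolding graded_frame_def by simp_all

text \<open>
  Only the graded relation ties \<open>\<top>\<close> to the meet, so this needs antisymmetry. It is what makes the
  iterated meet of a nonempty list, which ends in \<open>\<top>\<close>, agree with the plain binary meets.
\<close>

lemma meet_gtop:
  assumes A: "graded_frame A" and a: "a \<in> carr A"
  shows "meet A a (gtop A) = a"
proof -
  have top: "gtop A \<in> carr A" and m: "meet A a (gtop A) \<in> carr A"
    using A a by (simp_all add: graded_frame_closed)
  have "rel A (meet A a (gtop A)) a = 1"
    using graded_frame_rel(3)[OF A a top] .
  moreover have "rel A a (meet A a (gtop A)) = 1"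
    using graded_frame_rel(5)[OF A a a top] graded_frame_rel(1,4)[OF A a] by simp
  ultimately show ?thesis
    using graded_frame_rel(2)[OF A m a] by simp
qed

lemma foldr_meet_closed:
  assumes "graded_frame A" and "set as \<subseteq> carr A"
  shows "foldr (meet A) as (gtop A) \<in> carr A"
  using assms(2) by (induction as) (auto simp: graded_frame_closed[OF assms(1)])

lemma identity_gframe_hom:
  assumes "graded_frame A"
  shows "(\<lambda>a\<in>carr A. a) \<in> gframe_hom t A A"
proof (rule gframe_homI)
  show "(\<lambda>a\<in>carr A. a) (join A S) = join A ((\<lambda>a\<in>carr A. a) ` S)" if S: "S \<subseteq> carr A" for S
  proof -
    have "(\<lambda>a\<in>carr A. a) ` S = (\<lambda>a. a) ` S"
      using S by (intro image_cong) auto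
    then show ?thesis using S assms by (simp add: graded_frame_closed)
  qed
qed (use assms in \<open>auto simp: graded_frame_closed\<close>)

lemma compose_gframe_hom:
  assumes A: "graded_frame A" and f: "f \<in> gframe_hom t A B" and g: "g \<in> gframe_hom t B C"
  shows "compose (carr A) g f \<in> gframe_hom t A C"
proof (rule gframe_homI)
  note f_mem = gframe_hom_mem[OF f]
  show "compose (carr A) g f \<in> carr A \<rightarrow>\<^sub>E carr C"
    using f_mem gframe_hom_mem[OF g] by (auto simp: compose_def)
  show "compose (carr A) g f (join A S) = join C (compose (carr A) g f ` S)"
    if S: "S \<subseteq> carr A" for S
  proof -
    have "compose (carr A) g f (join A S) = join C (g ` f ` S)"
      using S f_mem
      using gframe_homD(4)[OF g, of "f ` S"]
      by (simp add: compose_eq graded_frame_closed(3)[OF A] gframe_homD(4)[OF f]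
          image_subset_iff subsetD)
    also have "g ` f ` S = compose (carr A) g f ` S"
      using S by (auto simp: image_image compose_eq intro!: image_cong)
    finally show ?thesis .
  qed
  show "rel A a b \<le> rel C (compose (carr A) g f a) (compose (carr A) g f b)"
    if "a \<in> carr A" "b \<in> carr A" for a b
    using that order_trans[OF gframe_homD(5)[OF f] gframe_homD(5)[OF g]] f_mem
    by (simp add: compose_eq)
qed (simp_all add: compose_eq graded_frame_closed[OF A] gframe_homD[OF f] gframe_homD[OF g]
      gframe_hom_mem[OF f])

lemma compose_gframe_hom_assoc:
  assumes "f \<in> gframe_hom t A B"
  shows "compose (carr A) h (compose (carr A) g f) = compose (carr A) (compose (carr B) h g) f"
  using compose_assoc[of f "carr A" "carr B"] gframe_homD(1)[OF assms] by (simp add: PiE_def)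

lemma compose_identity_gframe_hom:
  assumes "f \<in> gframe_hom t A B"
  shows "compose (carr A) f (\<lambda>a\<in>carr A. a) = f" "compose (carr A) (\<lambda>b\<in>carr B. b) f = f"
  using gframe_homD(1)[OF assms] by (auto simp: PiE_def intro: compose_Id Id_compose)

lemma is_category_Graded_Frm: "is_category (Graded_Frm t)"
  unfolding is_category_def Graded_Frm_def category.simps mem_Collect_eq
  by (intro conjI ballI)
    (auto intro: identity_gframe_hom compose_gframe_hom compose_identity_gframe_hom
      compose_gframe_hom_assoc[symmetric])

section \<open>Points of a system as homomorphisms into the unit interval\<close>

lemma unit_gframe_simps [simp]:
  "carr unit_gframe = {0..1}"
  "gtop unit_gframe = 1"
  "meet unit_gframe = min"
  "join unit_gframe = uSup"
  by (simp_all add: unit_gframe_def)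

lemma le_rel_unit_gframe_iff:
  assumes "r \<le> 1"
  shows "r \<le> rel unit_gframe p q \<longleftrightarrow> min p r \<le> q"
  using assms by (auto simp: unit_gframe_def)

lemma uInf_insert:
  assumes "finite S" and "x \<le> 1"
  shows "uInf (insert x S) = min x (uInf S)"
  using assms by (cases "S = {}") (simp_all add: uInf_def cInf_insert inf_min bdd_below_finite)

text \<open>
  When \<open>\<top>\<close> does not count as a meet, the induction has to stop at singletons, where the value is
  \<open>v (a \<and> \<top>) = v a\<close>, as nothing is known about \<open>v \<top>\<close>.
\<close>

lemma Hom_g_foldr_meet:
  assumes A: "graded_frame A" and v: "v \<in> Hom_g t A"
    and as: "set as \<subseteq> carr A" and ne: "t \<or> as \<noteq> []"
  shows "v (foldr (meet A) as (gtop A)) = uInf (v ` set as)"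
  using as ne
proof (induction as)
  case Nil
  then show ?case
    using v by (simp add: Hom_g_def gframe_homD(3) uInf_def)
next
  case (Cons a as)
  have hom: "v \<in> gframe_hom t A unit_gframe"
    using v by (simp add: Hom_g_def)
  have a: "a \<in> carr A" and le: "v a \<le> 1"
    using Cons.prems(1) gframe_hom_mem[OF hom, of a] by auto
  show ?case
  proof (cases "as = []")
    case True
    then show ?thesis
      by (simp add: meet_gtop[OF A a] uInf_def)
  next
    case False
    have "foldr (meet A) as (gtop A) \<in> carr A"
      using Cons.prems(1) by (intro foldr_meet_closed[OF A]) simp
    then show ?thesis
      using False Cons a le by (simp add: gframe_homD(2)[OF hom] uInf_insert)
  qed
qed

lemma sat_in_Hom_g:
  assumes X: "graded_fuzzy_topsys t X" and x: "x \<in> points X"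
  shows "(\<lambda>a\<in>carr (frame X). sat X x a) \<in> Hom_g t (frame X)"
  unfolding Hom_g_def
proof (rule gframe_homI)
  let ?A = "frame X"
  have A: "graded_frame ?A"
    using X by (simp add: graded_fuzzy_topsys_def)
  have range: "sat X x a \<in> {0..1}" if "a \<in> carr ?A" for a
    using X x that unfolding graded_fuzzy_topsys_def by blast
  have fold: "sat X x (foldr (meet ?A) as (gtop ?A)) = uInf {sat X x a |a. a \<in> set as}"
    if "set as \<subseteq> carr ?A" "t \<or> as \<noteq> []" for as
    using X x that unfolding graded_fuzzy_topsys_def by blast
  show "(\<lambda>a\<in>carr ?A. sat X x a) \<in> carr ?A \<rightarrow>\<^sub>E carr unit_gframe"
    using range by simp
  show "(\<lambda>a\<in>carr ?A. sat X x a) (meet ?A a b) =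
      meet unit_gframe ((\<lambda>a\<in>carr ?A. sat X x a) a) ((\<lambda>a\<in>carr ?A. sat X x a) b)"
    if a: "a \<in> carr ?A" and b: "b \<in> carr ?A" for a b
  proof -
    have "{sat X x c |c. c \<in> set [a, b]} = {sat X x a, sat X x b}"
      by auto
    then have "sat X x (meet ?A a b) = uInf {sat X x a, sat X x b}"
      using fold[of "[a, b]"] a b by (simp add: meet_gtop[OF A])
    also have "\<dots> = min (sat X x a) (sat X x b)"
      using range[OF a] range[OF b] by (simp add: uInf_insert) (simp add: uInf_def)
    finally show ?thesis
      using a b by (simp add: graded_frame_closed[OF A])
  qed
  show "(\<lambda>a\<in>carr ?A. sat X x a) (gtop ?A) = gtop unit_gframe" if t
    using fold[of "[]"] that by (simp add: graded_frame_closed[OF A] uInf_def)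
  show "(\<lambda>a\<in>carr ?A. sat X x a) (join ?A S) = join unit_gframe ((\<lambda>a\<in>carr ?A. sat X x a) ` S)"
    if S: "S \<subseteq> carr ?A" for S
  proof -
    have "sat X x (join ?A S) = uSup {sat X x a |a. a \<in> S}"
      using X x S unfolding graded_fuzzy_topsys_def by blast
    moreover have "{sat X x a |a. a \<in> S} = (\<lambda>a\<in>carr ?A. sat X x a) ` S"
      using S by force
    ultimately show ?thesis
      using S by (simp add: graded_frame_closed[OF A])
  qed
  show "rel ?A a b \<le> rel unit_gframe ((\<lambda>a\<in>carr ?A. sat X x a) a) ((\<lambda>a\<in>carr ?A. sat X x a) b)"
    if a: "a \<in> carr ?A" and b: "b \<in> carr ?A" for a b
  proof -
    have "min (sat X x a) (rel ?A a b) \<le> sat X x b"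
      using X x a b unfolding graded_fuzzy_topsys_def by blast
    then show ?thesis
      using a b by (simp add: le_rel_unit_gframe_iff[OF graded_frame_rel(6)[OF A]])
  qed
qed

lemma graded_fuzzy_topsys_S_g:
  assumes A: "graded_frame A"
  shows "graded_fuzzy_topsys t (omap (S_g t) A)"
proof -
  have "min (v a) (rel A a b) \<le> v b"
    if v: "v \<in> Hom_g t A" and a: "a \<in> carr A" and b: "b \<in> carr A" for v a b
    using gframe_homD(5)[OF v[unfolded Hom_g_def] a b]
    by (simp add: le_rel_unit_gframe_iff[OF graded_frame_rel(6)[OF A a b]])
  moreover have "v a \<in> {0..1}" if "v \<in> Hom_g t A" "a \<in> carr A" for v a
    using gframe_hom_mem[OF that(1)[unfolded Hom_g_def] that(2)] by simp
  moreover have "v (join A S) = uSup (v ` S)" if "v \<in> Hom_g t A" "S \<subseteq> carr A" for v S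
    using gframe_homD(4)[OF that(1)[unfolded Hom_g_def] that(2)] by simp
  ultimately show ?thesis
    using A Hom_g_foldr_meet[OF A, of _ t]
    unfolding graded_fuzzy_topsys_def S_g_def by (simp add: Setcompr_eq_image)
qed

text \<open>The constant \<open>0\<close> preserves every join, including the empty one, and misses only \<open>\<top>\<close>.\<close>

lemma Hom_g_False_nonempty:
  assumes A: "graded_frame A"
  shows "Hom_g False A \<noteq> {}"
proof -
  have "(\<lambda>a\<in>carr A. 0) \<in> Hom_g False A"
    unfolding Hom_g_def
  proof (rule gframe_homI)
    show "(\<lambda>a\<in>carr A. 0) (join A S) = join unit_gframe ((\<lambda>a\<in>carr A. 0) ` S)"
      if S: "S \<subseteq> carr A" for S
    proof (cases "S = {}")
      case True
      then show ?thesis by (simp add: graded_frame_closed[OF A] uSup_def)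
    next
      case False
      then have "(\<lambda>a\<in>carr A. 0::real) ` S = {0}"
        using S by force
      then show ?thesis
        using S by (simp add: graded_frame_closed[OF A] uSup_def)
    qed
    show "rel A a b \<le> rel unit_gframe ((\<lambda>a\<in>carr A. 0) a) ((\<lambda>a\<in>carr A. 0) b)"
      if "a \<in> carr A" "b \<in> carr A" for a b
      using that graded_frame_rel(6)[OF A] by (simp add: unit_gframe_def)
  qed (auto simp: graded_frame_closed[OF A])
  then show ?thesis by blast
qed

section \<open>The category of systems and the two functors\<close>

lemma gsys_hom_compose:
  assumes Z: "graded_frame (frame Z)"
    and f: "(f1, f2) \<in> gsys_hom t X Y" and g: "(g1, g2) \<in> gsys_hom t Y Z"
  shows "(compose (points X) g1 f1, compose (carr (frame Z)) f2 g2) \<in> gsys_hom t X Z"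
proof -
  have "f2 \<in> gframe_hom t (frame Y) (frame X)" "g2 \<in> gframe_hom t (frame Z) (frame Y)"
    using f g by (simp_all add: gsys_hom_def)
  then have "compose (carr (frame Z)) f2 g2 \<in> gframe_hom t (frame Z) (frame X)"
    and "\<And>b. b \<in> carr (frame Z) \<Longrightarrow> g2 b \<in> carr (frame Y)"
    using Z by (auto intro: compose_gframe_hom gframe_hom_mem)
  moreover have "f1 \<in> points X \<rightarrow> points Y" "g1 \<in> points Y \<rightarrow> points Z"
    using f g by (auto simp: gsys_hom_def)
  ultimately show ?thesis
    using f g by (auto simp: gsys_hom_def compose_eq compose_def Pi_iff)
qed

lemma Graded_Fuzzy_TopSys_simps:
  "obj (Graded_Fuzzy_TopSys t) = {X. graded_fuzzy_topsys t X}"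
  "arr (Graded_Fuzzy_TopSys t) = gsys_hom t"
  "idt (Graded_Fuzzy_TopSys t) X = (\<lambda>x\<in>points X. x, \<lambda>a\<in>carr (frame X). a)"
  "cmp (Graded_Fuzzy_TopSys t) X Y Z (g1, g2) (f1, f2) =
     (compose (points X) g1 f1, compose (carr (frame Z)) f2 g2)"
  by (simp_all add: Graded_Fuzzy_TopSys_def)

lemma is_category_Graded_Fuzzy_TopSys:
  "is_category (Graded_Fuzzy_TopSys t :: (('x, 'a) gsys, _) category)"
proof -
  have frame: "graded_frame (frame X)" if "graded_fuzzy_topsys t X" for X :: "('x, 'a) gsys"
    using that by (simp add: graded_fuzzy_topsys_def)
  have hom: "f2 \<in> gframe_hom t (frame Y) (frame X)" "f1 \<in> points X \<rightarrow> points Y"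
    "f1 \<in> extensional (points X)"
    if "(f1, f2) \<in> gsys_hom t X Y" for f1 f2 and X Y :: "('x, 'a) gsys"
    using that by (auto simp: gsys_hom_def PiE_def)
  have ident: "(\<lambda>x\<in>points X. x, \<lambda>a\<in>carr (frame X). a) \<in> gsys_hom t X X"
    if "graded_fuzzy_topsys t X" for X :: "('x, 'a) gsys"
    using identity_gframe_hom[OF frame[OF that]] by (auto simp: gsys_hom_def)
  have unit: "compose (points X) f1 (\<lambda>x\<in>points X. x) = f1"
    "compose (points X) (\<lambda>y\<in>points Y. y) f1 = f1"
    "compose (carr (frame Y)) (\<lambda>a\<in>carr (frame X). a) f2 = f2"
    "compose (carr (frame Y)) f2 (\<lambda>a\<in>carr (frame Y). a) = f2"
    if f: "(f1, f2) \<in> gsys_hom t X Y" for f1 f2 and X Y :: "('x, 'a) gsys"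
    using hom[OF f] by (auto intro: compose_Id Id_compose compose_identity_gframe_hom)
  have assoc:
    "compose (points W) (compose (points X) h1 g1) f1 =
       compose (points W) h1 (compose (points W) g1 f1)"
    "compose (carr (frame Z)) f2 (compose (carr (frame Z)) g2 h2) =
       compose (carr (frame Z)) (compose (carr (frame Y)) f2 g2) h2"
    if f: "(f1, f2) \<in> gsys_hom t W X" and g: "(g1, g2) \<in> gsys_hom t X Y"
      and h: "(h1, h2) \<in> gsys_hom t Y Z"
    for f1 f2 g1 g2 h1 h2 and W X Y Z :: "('x, 'a) gsys"
    by (rule compose_assoc[OF hom(2)[OF f], symmetric])
      (rule compose_gframe_hom_assoc[OF hom(1)[OF h]])
  show ?thesis
    unfolding is_category_def Graded_Fuzzy_TopSys_simps(1,2)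
  proof (intro conjI ballI; unfold mem_Collect_eq)
    show "idt (Graded_Fuzzy_TopSys t) X \<in> gsys_hom t X X"
      if "graded_fuzzy_topsys t X" for X :: "('x, 'a) gsys"
      using ident[OF that] by (simp add: Graded_Fuzzy_TopSys_simps(3))
    show "cmp (Graded_Fuzzy_TopSys t) X Y Z g f \<in> gsys_hom t X Z"
      if "graded_fuzzy_topsys t Z" "f \<in> gsys_hom t X Y" "g \<in> gsys_hom t Y Z"
      for X Y Z :: "('x, 'a) gsys" and f g
      using that gsys_hom_compose[OF frame]
      by (cases f; cases g) (simp add: Graded_Fuzzy_TopSys_simps(4))
    show "cmp (Graded_Fuzzy_TopSys t) X X Y f (idt (Graded_Fuzzy_TopSys t) X) = f"
      "cmp (Graded_Fuzzy_TopSys t) X Y Y (idt (Graded_Fuzzy_TopSys t) Y) f = f"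
      if "f \<in> gsys_hom t X Y" for X Y :: "('x, 'a) gsys" and f
      using that unit by (cases f; simp add: Graded_Fuzzy_TopSys_simps(3,4))+
    show "cmp (Graded_Fuzzy_TopSys t) W X Z (cmp (Graded_Fuzzy_TopSys t) X Y Z h g) f =
        cmp (Graded_Fuzzy_TopSys t) W Y Z h (cmp (Graded_Fuzzy_TopSys t) W X Y g f)"
      if f: "f \<in> gsys_hom t W X" and g: "g \<in> gsys_hom t X Y" and h: "h \<in> gsys_hom t Y Z"
      for W X Y Z :: "('x, 'a) gsys" and f g h
    proof -
      obtain f1 f2 g1 g2 h1 h2 where eq: "f = (f1, f2)" "g = (g1, g2)" "h = (h1, h2)"
        by (metis surj_pair)
      show ?thesis
        unfolding eq Graded_Fuzzy_TopSys_simps(4)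
        using assoc[OF f[unfolded eq] g[unfolded eq] h[unfolded eq]] by (rule arg_cong2)
    qed
  qed
qed

lemma op_Graded_Frm_simps:
  "obj (op_cat (Graded_Frm t)) = {A. graded_frame A}"
  "arr (op_cat (Graded_Frm t)) A B = gframe_hom t B A"
  "idt (op_cat (Graded_Frm t)) A = (\<lambda>a\<in>carr A. a)"
  "cmp (op_cat (Graded_Frm t)) A B C g f = compose (carr C) f g"
  by (simp_all add: op_cat_def Graded_Frm_def)

lemma is_functor_fm_g: "is_functor (Graded_Fuzzy_TopSys t) (op_cat (Graded_Frm t)) fm_g"
  unfolding is_functor_def op_Graded_Frm_simps
  by (auto simp: Graded_Fuzzy_TopSys_simps fm_g_def graded_fuzzy_topsys_def gsys_hom_def)

lemma S_g_simps:
  "points (omap (S_g t) A) = Hom_g t A"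
  "sat (omap (S_g t) A) = (\<lambda>v a. v a)"
  "frame (omap (S_g t) A) = A"
  "amap (S_g t) A B f = (\<lambda>v\<in>Hom_g t A. compose (carr B) v f, f)"
  by (simp_all add: S_g_def)

lemma compose_Hom_g:
  assumes "graded_frame B" and "f \<in> gframe_hom t B A" and "v \<in> Hom_g t A"
  shows "compose (carr B) v f \<in> Hom_g t B"
  using assms unfolding Hom_g_def by (rule compose_gframe_hom)

lemma is_functor_S_g:
  "is_functor (op_cat (Graded_Frm t)) (Graded_Fuzzy_TopSys t)
     (S_g t :: ('a gframe, 'a \<Rightarrow> 'a, ('a \<Rightarrow> real, 'a) gsys, _) cat_functor)"
proof -
  have arrow: "amap (S_g t) A B f \<in> gsys_hom t (omap (S_g t) A) (omap (S_g t) B)"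
    if B: "graded_frame B" and f: "f \<in> gframe_hom t B A" for A B and f :: "'a \<Rightarrow> 'a"
    using f compose_Hom_g[OF B f] by (auto simp: gsys_hom_def S_g_simps compose_eq)
  have ident: "amap (S_g t) A A (\<lambda>a\<in>carr A. a) = idt (Graded_Fuzzy_TopSys t) (omap (S_g t) A)"
    for A :: "'a gframe"
  proof -
    have "compose (carr A) v (\<lambda>a\<in>carr A. a) = v" if "v \<in> Hom_g t A" for v
      using that compose_identity_gframe_hom(1) unfolding Hom_g_def by blast
    then show ?thesis
      by (auto simp: S_g_simps Graded_Fuzzy_TopSys_simps)
  qed
  have comp: "amap (S_g t) A C (compose (carr C) f g) =
      cmp (Graded_Fuzzy_TopSys t) (omap (S_g t) A) (omap (S_g t) B) (omap (S_g t) C)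
        (amap (S_g t) B C g) (amap (S_g t) A B f)"
    if B: "graded_frame B" and f: "f \<in> gframe_hom t B A" and g: "g \<in> gframe_hom t C B"
    for A B C and f g :: "'a \<Rightarrow> 'a"
    using compose_Hom_g[OF B f] compose_gframe_hom_assoc[OF g]
    by (auto simp: S_g_simps Graded_Fuzzy_TopSys_simps compose_def[of "Hom_g t A"]
        intro!: restrict_ext)
  show ?thesis
    unfolding is_functor_def op_Graded_Frm_simps
    using arrow ident comp
    by (auto simp: Graded_Fuzzy_TopSys_simps(1,2) graded_fuzzy_topsys_S_g)
qed

section \<open>The adjunction\<close>

text \<open>
  The transpose of \<open>g\<close> sends a point \<open>x\<close> to its evaluation, pulled back along \<open>g\<close>; for the identity
  \<open>g\<close> this is the unit of the adjunction.
\<close>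

definition system_transpose ::
  "('x, 'a) gsys \<Rightarrow> 'b gframe \<Rightarrow> ('b \<Rightarrow> 'a) \<Rightarrow> ('x \<Rightarrow> 'b \<Rightarrow> real) \<times> ('b \<Rightarrow> 'a)"
  where "system_transpose X B g = (\<lambda>x\<in>points X. \<lambda>b\<in>carr B. sat X x (g b), g)"

lemma system_transpose_in_gsys_hom:
  assumes X: "graded_fuzzy_topsys t X" and B: "graded_frame B"
    and g: "g \<in> gframe_hom t B (frame X)"
  shows "system_transpose X B g \<in> gsys_hom t X (omap (S_g t) B)"
proof -
  have "(\<lambda>b\<in>carr B. sat X x (g b)) \<in> Hom_g t B" if x: "x \<in> points X" for x
  proof -
    have "compose (carr B) (\<lambda>a\<in>carr (frame X). sat X x a) g \<in> Hom_g t B"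
      by (rule compose_Hom_g[OF B g sat_in_Hom_g[OF X x]])
    also have "compose (carr B) (\<lambda>a\<in>carr (frame X). sat X x a) g = (\<lambda>b\<in>carr B. sat X x (g b))"
      using gframe_hom_mem[OF g] by (auto simp: compose_def)
    finally show ?thesis .
  qed
  then show ?thesis
    using g by (auto simp: system_transpose_def gsys_hom_def S_g_simps)
qed

text \<open>Points of \<open>S_g(B)\<close> are extensional, so the satisfaction condition recovers \<open>f\<^sub>1\<close> from \<open>f\<^sub>2\<close>.\<close>

lemma gsys_hom_S_g_eq_system_transpose:
  assumes f: "(f1, f2) \<in> gsys_hom t X (omap (S_g t) B)"
  shows "(f1, f2) = system_transpose X B f2"
proof -
  have f1: "f1 \<in> points X \<rightarrow>\<^sub>E Hom_g t B"
    and sat: "\<And>x b. x \<in> points X \<Longrightarrow> b \<in> carr B \<Longrightarrow> sat X x (f2 b) = f1 x b"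
    using f by (auto simp: gsys_hom_def S_g_simps)
  have "f1 x = (\<lambda>b\<in>carr B. sat X x (f2 b))" if x: "x \<in> points X" for x
  proof (rule extensionalityI)
    show "f1 x \<in> extensional (carr B)"
      using f1 x by (auto simp: Hom_g_def intro: gframe_hom_extensional)
  qed (use sat x in auto)
  then have "f1 = (\<lambda>x\<in>points X. \<lambda>b\<in>carr B. sat X x (f2 b))"
    using f1 by (intro extensionalityI[of _ "points X"]) (auto simp: PiE_def)
  then show ?thesis
    by (simp add: system_transpose_def)
qed

lemma bij_betw_system_transpose:
  assumes "graded_fuzzy_topsys t X" and "graded_frame B"
  shows "bij_betw (system_transpose X B) (gframe_hom t B (frame X)) (gsys_hom t X (omap (S_g t) B))"
proof (rule bij_betwI[where g = snd])
  show "system_transpose X B \<in> gframe_hom t B (frame X) \<rightarrow> gsys_hom t X (omap (S_g t) B)"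
    using assms by (simp add: system_transpose_in_gsys_hom)
  show "snd \<in> gsys_hom t X (omap (S_g t) B) \<rightarrow> gframe_hom t B (frame X)"
    by (auto simp: gsys_hom_def S_g_simps)
  show "snd (system_transpose X B g) = g" for g
    by (simp add: system_transpose_def)
  show "system_transpose X B (snd p) = p" if "p \<in> gsys_hom t X (omap (S_g t) B)" for p
    using that gsys_hom_S_g_eq_system_transpose[of "fst p" "snd p"] by simp
qed

text \<open>
  At a point \<open>x\<close> the two sides are \<open>gr(x \<Turnstile> f\<^sub>2(g(h(b))))\<close> and \<open>gr(f\<^sub>1(x) \<Turnstile> g(h(b)))\<close>, which agree as
  \<open>(f\<^sub>1, f\<^sub>2)\<close> is an arrow of systems.
\<close>

lemma system_transpose_natural:
  assumes X: "graded_fuzzy_topsys t X" and Y: "graded_frame Y"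
    and f: "(f1, f2) \<in> gsys_hom t X' X"
    and g: "g \<in> gframe_hom t Y (frame X)" and h: "h \<in> gframe_hom t Y' Y"
  shows "system_transpose X' Y' (compose (carr Y') (compose (carr Y) f2 g) h) =
    cmp (Graded_Fuzzy_TopSys t) X' (omap (S_g t) Y) (omap (S_g t) Y') (amap (S_g t) Y Y' h)
      (cmp (Graded_Fuzzy_TopSys t) X' X (omap (S_g t) Y) (system_transpose X Y g) (f1, f2))"
proof -
  have f1: "f1 x \<in> points X" if "x \<in> points X'" for x
    using f that by (auto simp: gsys_hom_def)
  have sat: "sat X' x (f2 a) = sat X (f1 x) a" if "x \<in> points X'" "a \<in> carr (frame X)" for x a
    using f that by (auto simp: gsys_hom_def)
  have point: "(\<lambda>b\<in>carr Y. sat X x (g b)) \<in> Hom_g t Y" if "x \<in> points X" for x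
    using system_transpose_in_gsys_hom[OF X Y g] that
    by (auto simp: system_transpose_def gsys_hom_def S_g_simps)
  show ?thesis
    using f1 point gframe_hom_mem[OF h] gframe_hom_mem[OF g]
    by (auto simp: system_transpose_def S_g_simps Graded_Fuzzy_TopSys_simps compose_def sat
        intro!: restrict_ext)
qed

theorem left_adjoint_fm_g_S_g:
  "left_adjoint (Graded_Fuzzy_TopSys t) (op_cat (Graded_Frm t)) fm_g (S_g t)"
proof -
  have natural: "\<forall>X\<in>obj (Graded_Fuzzy_TopSys t). \<forall>X'\<in>obj (Graded_Fuzzy_TopSys t).
      \<forall>Y\<in>{A. graded_frame A}. \<forall>Y'\<in>{A. graded_frame A}.
      \<forall>f\<in>arr (Graded_Fuzzy_TopSys t) X' X.
      \<forall>g\<in>gframe_hom t Y (omap fm_g X). \<forall>h\<in>gframe_hom t Y' Y.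
      system_transpose X' Y' (compose (carr Y') (compose (carr Y) (amap fm_g X' X f) g) h) =
      cmp (Graded_Fuzzy_TopSys t) X' (omap (S_g t) Y) (omap (S_g t) Y') (amap (S_g t) Y Y' h)
        (cmp (Graded_Fuzzy_TopSys t) X' X (omap (S_g t) Y) (system_transpose X Y g) f)"
    by (auto simp: Graded_Fuzzy_TopSys_simps(1,2) fm_g_def system_transpose_natural)
  show ?thesis
    unfolding left_adjoint_def
    using is_category_Graded_Fuzzy_TopSys is_category_op_cat[OF is_category_Graded_Frm]
      is_functor_fm_g is_functor_S_g natural
    unfolding op_Graded_Frm_simps
    by (intro conjI exI[of _ system_transpose])
      (simp_all add: Graded_Fuzzy_TopSys_simps(1,2) fm_g_def bij_betw_system_transpose)
qed

lemma Hom_g_frame_nonempty: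
  assumes "X \<in> obj (Graded_Fuzzy_TopSys t)" and "points X \<noteq> {}"
  shows "Hom_g t (omap fm_g X) \<noteq> {}"
  using assms sat_in_Hom_g[of t X] by (auto simp: Graded_Fuzzy_TopSys_simps(1) fm_g_def)

theorem left_adjoint_fm_g_S_g_nonempty:
  "left_adjoint (full_subcat (Graded_Fuzzy_TopSys t) (\<lambda>X. points X \<noteq> {}))
     (op_cat (full_subcat (Graded_Frm t) (\<lambda>A. Hom_g t A \<noteq> {}))) fm_g (S_g t)"
  unfolding op_cat_full_subcat
  by (rule left_adjoint_full_subcat[OF left_adjoint_fm_g_S_g])
    (simp_all add: Hom_g_frame_nonempty S_g_simps)

lemma full_subcat_Graded_Frm_False:
  "full_subcat (Graded_Frm False) (\<lambda>A. Hom_g False A \<noteq> {}) = Graded_Frm False"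
  by (rule full_subcat_eq_self) (simp add: Graded_Frm_def Hom_g_False_nonempty)

theorem lemma7p4p1:
  shows
    "left_adjoint (Graded_Fuzzy_TopSys True) (op_cat (Graded_Frm True))
       fm_g (S_g True :: ('a gframe, 'a \<Rightarrow> 'a, ('a \<Rightarrow> real, 'a) gsys, _) cat_functor) \<and>
     left_adjoint (full_subcat (Graded_Fuzzy_TopSys True) (\<lambda>X. points X \<noteq> {}))
       (op_cat (full_subcat (Graded_Frm True) (\<lambda>A. Hom_g True A \<noteq> {})))
       fm_g (S_g True :: ('a gframe, 'a \<Rightarrow> 'a, ('a \<Rightarrow> real, 'a) gsys, _) cat_functor) \<and>
     left_adjoint (full_subcat (Graded_Fuzzy_TopSys False) (\<lambda>X. points X \<noteq> {}))
       (op_cat (Graded_Frm False))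
       fm_g (S_g False :: ('a gframe, 'a \<Rightarrow> 'a, ('a \<Rightarrow> real, 'a) gsys, _) cat_functor)"
  using left_adjoint_fm_g_S_g left_adjoint_fm_g_S_g_nonempty
    left_adjoint_fm_g_S_g_nonempty[of False, unfolded full_subcat_Graded_Frm_False]
  by blast

end
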